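(* For a generic D2D transmitter, the probability $p_f$ that the D2D channel $c_d$ is free is $$p_f=\exp[-\theta q_d],\qquad \theta=\begin{cases}\pi\lambda_B\left(\frac{P_B}{\gamma}\right)^{\frac2\alpha}\Gamma\left(\frac{\alpha+2}{\alpha}\right), & c_d\in\mathcal{C}_D,\\ \left(\frac{\rho_b}{\gamma}\right)^{\frac2\alpha}\Gamma\left(\frac{\alpha+2}{\alpha}\right), & c_d\in\mathcal{C}_U,\end{cases}$$ where $q_d$ is the probability that the D2D channel is used by a generic base station for cellular communication (under either the RSA or the PSA policy).
   Context: Parameters (all positive reals): densities $\lambda_B$ of base stations (BSs) and $\lambda_U$ of cellular users; BS transmit power $P_B$; BS receiver sensitivity $\rho_b$; sensing threshold $\gamma$; path-loss exponent $\alpha>2$. A finite set of channels $\mathcal{C}$ is the disjoint union of $\mathcal{C}_D$ (downlink) and $\mathcal{C}_U$ (uplink); $c_d\in\mathcal{C}$ is the D2D channel. PPP means Poisson point process on $\mathbb{R}^2$. The number $N_u$ of users of a BS has pmf $\mathbb{P}\{N_u=n\}=\frac{b^b}{\Gamma(b)}\frac{\Gamma(n+b)}{\Gamma(n+1)}\frac{m^n}{(b+m)^{n+b}}$, $n\ge0$, $b=3.575$, $m=\lambda_U/\lambda_B$. Under the random spectrum access (RSA) policy $q_d=1-\sum_{n=0}^{|\mathcal{C}|-1}\frac{|\mathcal{C}|-n}{|\mathcal{C}|}\mathbb{P}\{N_u=n\}$; under the prioritized spectrum access (PSA) policy $q_d=1-\sum_{n=0}^{|\mathcal{C}|-1}\mathbb{P}\{N_u=n\}$.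 The D2D transmitter is at the origin. The cellular transmitters using $c_d$ form a PPP of intensity $q_d\lambda_B$; each such transmitter $x$ carries an independent fading gain $h_x\sim\mathrm{Exp}(1)$ and a transmit power $P_x$. If $c_d\in\mathcal{C}_D$ the transmitters are BSs and $P_x=P_B$. If $c_d\in\mathcal{C}_U$ they are cellular users and the $P_x$ are i.i.d., independent of everything else, distributed as $\rho_bR^\alpha$ with $R$ of density $2\pi\lambda_Bre^{-\pi\lambda_Br^2}$, $r>0$ (channel inversion to the nearest BS). The channel $c_d$ is free iff no transmitter $x$ satisfies $P_xh_x\|x\|^{-\alpha}>\gamma$. *)

theory Defs
  imports "HOL-Probability.Probability"
begin

text \<open>The argument \<open>m\<close> is the mean number of users per base station.\<close>

definition user_count_density :: "real \<Rightarrow> nat \<Rightarrow> real" where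
  "user_count_density m n =
     (let b = 3.575 in
        b powr b / Gamma b * (Gamma (real n + b) / Gamma (real n + 1)) *
        (m ^ n / (b + m) powr (real n + b)))"

definition user_count_pmf :: "real \<Rightarrow> nat pmf" where
  "user_count_pmf m = embed_pmf (user_count_density m)"

lemma user_count_density_sums:
  assumes "m > 0"
  shows "user_count_density m sums 1"
proof -
  define b :: real where "b = 3.575"
  have b: "b > 0" by (simp add: b_def)
  define z where "z = - m / (b + m)"
  have "\<bar>z\<bar> < 1" using assms b by (simp add: z_def abs_if field_simps)
  from gen_binomial_real[OF this, of "- b"]
  have "(\<lambda>n. ((- b) gchoose n) * z ^ n) sums (1 + z) powr (- b)" .
  then have "(\<lambda>n. (b / (b + m)) powr b * (((- b) gchoose n) * z ^ n)) sums
      ((b / (b + m)) powr b * (1 + z) powr (- b))"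
    by (rule sums_mult)
  moreover have "1 + z = b / (b + m)"
    using assms b by (simp add: z_def field_simps)
  then have "(b / (b + m)) powr b * (1 + z) powr (- b) = 1"
    using assms b by (simp add: powr_minus)
  moreover have "(b / (b + m)) powr b * (((- b) gchoose n) * z ^ n) = user_count_density m n" for n
  proof -
    have "b \<notin> \<int>\<^sub>\<le>\<^sub>0" using b by (auto elim!: nonpos_Ints_cases)
    then have "pochhammer b n = Gamma (b + real n) / Gamma b"
      by (rule pochhammer_Gamma)
    then have choose: "((- b) gchoose n) = (-1) ^ n * (Gamma (b + real n) / Gamma b) / fact n"
      by (simp add: gbinomial_pochhammer)
    have sign: "(- 1) ^ n * z ^ n = (m / (b + m)) ^ n"
      by (simp add: z_def flip: power_mult_distrib)
    have fact: "(fact n :: real) = Gamma (real n + 1)"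
      by (simp add: Gamma_fact add.commute)
    have power: "(b + m) powr (real n + b) = (b + m) ^ n * (b + m) powr b"
      using assms b by (simp add: powr_add powr_realpow)
    have density: "user_count_density m n =
        b powr b / Gamma b * (Gamma (real n + b) / Gamma (real n + 1)) *
        (m ^ n / (b + m) powr (real n + b))"
      by (simp only: user_count_density_def Let_def b_def)
    have "((- b) gchoose n) * z ^ n =
        (Gamma (b + real n) / Gamma b) / fact n * ((- 1) ^ n * z ^ n)"
      by (simp add: choose)
    also have "(b / (b + m)) powr b * \<dots> = user_count_density m n"
      using assms b unfolding sign fact density power
      by (simp add: powr_divide power_divide mult_ac add.commute)
    finally show ?thesis .
  qed
  ultimately show ?thesis by simp
qed

lemma user_count_density_nonneg: "m > 0 \<Longrightarrow> user_count_density m n \<ge> 0"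
  by (simp add: user_count_density_def Let_def Gamma_real_nonneg)

lemma pmf_user_count_pmf:
  assumes "m > 0"
  shows "pmf (user_count_pmf m) n = user_count_density m n"
  unfolding user_count_pmf_def
proof (rule pmf_embed_pmf)
  show "(\<integral>\<^sup>+ n. ennreal (user_count_density m n) \<partial>count_space UNIV) = 1"
    using user_count_density_sums[OF assms] user_count_density_nonneg[OF assms]
    by (simp add: nn_integral_count_space_nat suminf_ennreal2 sums_iff)
qed (use user_count_density_nonneg[OF assms] in auto)

datatype access_policy = RSA | PSA

text \<open>Probability that a given channel, out of \<open>K\<close> channels, is used by a base station
  whose number of users has distribution \<open>N\<close>. Under \<open>PSA\<close> the channel in question is the
  one that is allocated last.\<close>

fun channel_use_prob :: "access_policy \<Rightarrow> nat \<Rightarrow> nat pmf \<Rightarrow> real" where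
  "channel_use_prob RSA K N = 1 - (\<Sum>n<K. (real K - real n) / real K * pmf N n)"
| "channel_use_prob PSA K N = 1 - (\<Sum>n<K. pmf N n)"

text \<open>A homogeneous Poisson point process of intensity \<open>lam > 0\<close> on a Euclidean space,
  given by an enumeration \<open>X 0, X 1, \<dots>\<close> of its (almost surely infinitely many) points.
  The number of points in \<open>A\<close> is the number of indices \<open>i\<close> with \<open>X i \<omega> \<in> A\<close>; the finiteness
  conjunct is there because \<open>card\<close> is 0 on infinite sets.\<close>

definition poisson_process ::
    "'w measure \<Rightarrow> real \<Rightarrow> (nat \<Rightarrow> 'w \<Rightarrow> 'a :: euclidean_space) \<Rightarrow> bool" where
  "poisson_process M lam X \<longleftrightarrow>
     (\<forall>i. X i \<in> borel_measurable M) \<and>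
     (\<forall>A n. A \<in> sets borel \<and> bounded A \<longrightarrow>
        measure M {\<omega> \<in> space M. finite {i. X i \<omega> \<in> A} \<and> card {i. X i \<omega> \<in> A} = n} =
          (lam * measure lborel A) ^ n / fact n * exp (- (lam * measure lborel A))) \<and>
     (\<forall>(A :: nat \<Rightarrow> 'a set) k.
        (\<forall>j<k. A j \<in> sets borel \<and> bounded (A j)) \<and> disjoint_family_on A {..<k} \<longrightarrow>
        prob_space.indep_vars M (\<lambda>_. count_space UNIV)
          (\<lambda>j \<omega>. card {i. X i \<omega> \<in> A j}) {..<k})"

text \<open>The marks \<open>Z i\<close> of the points \<open>X i\<close> are i.i.d. with law \<open>Q\<close>, and the sequence of
  marks is independent of the sequence of points.\<close>

definition independent_marks ::
    "'w measure \<Rightarrow> (nat \<Rightarrow> 'w \<Rightarrow> 'a :: euclidean_space) \<Rightarrow> 'm measure \<Rightarrow> (nat \<Rightarrow> 'w \<Rightarrow> 'm) \<Rightarrow> bool"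
  where
  "independent_marks M X Q Z \<longleftrightarrow>
     prob_space.indep_vars M (\<lambda>_. Q) Z UNIV \<and>
     (\<forall>i. distr M Q (Z i) = Q) \<and>
     prob_space.indep_set M
       (sets (vimage_algebra (space M) (\<lambda>\<omega> i. X i \<omega>) (Pi\<^sub>M UNIV (\<lambda>_. borel))))
       (sets (vimage_algebra (space M) (\<lambda>\<omega> i. Z i \<omega>) (Pi\<^sub>M UNIV (\<lambda>_. Q))))"

definition fading_law :: "real measure" where
  "fading_law = density lborel (exponential_density 1)"

definition nearest_bs_distance_law :: "real \<Rightarrow> real measure" where
  "nearest_bs_distance_law lam_B =
     density lborel (\<lambda>r. ennreal (if r > 0 then 2 * pi * lam_B * r * exp (- pi * lam_B * r\<^sup>2) else 0))"

definition inversion_power_law :: "real \<Rightarrow> real \<Rightarrow> real \<Rightarrow> real measure" where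
  "inversion_power_law lam_B \<rho>\<^sub>b \<alpha> =
     distr (nearest_bs_distance_law lam_B) borel (\<lambda>r. \<rho>\<^sub>b * r powr \<alpha>)"

text \<open>The sensing device is located at the origin. A transmitter at the origin would contribute
  \<open>0 powr (- \<alpha>) = 0\<close>, but almost surely there is none.\<close>

definition channel_free_event ::
    "'w measure \<Rightarrow> real \<Rightarrow> real \<Rightarrow> (nat \<Rightarrow> 'w \<Rightarrow> 'a :: euclidean_space) \<Rightarrow>
      (nat \<Rightarrow> 'w \<Rightarrow> real) \<Rightarrow> (nat \<Rightarrow> 'w \<Rightarrow> real) \<Rightarrow> 'w set" where
  "channel_free_event M \<alpha> \<gamma> X P h =
     {\<omega> \<in> space M. \<not> (\<exists>i. P i \<omega> * h i \<omega> * norm (X i \<omega>) powr (- \<alpha>) > \<gamma>)}"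

end

theory Submission
  imports Defs "HOL-Real_Asymp.Real_Asymp"
begin

text \<open>
  Given the points, the marks are independent, so the channel is free with conditional probability
  \<open>\<Prod>i. 1 - v (X i)\<close>, where \<open>v x\<close> is the probability that a transmitter at \<open>x\<close> is sensed above the
  threshold. The expectation of this product is \<open>exp (- lam * \<integral>v)\<close>: for simple \<open>v\<close> of bounded
  support by independence of the Poisson counts of the level sets, and in general by monotone
  approximation. By Fubini, \<open>\<integral>v\<close> is the mean area of the disc in which a transmitter is sensed,
  that is \<open>pi\<close> times the moment of order \<open>2 / \<alpha>\<close> of \<open>P * h / \<gamma>\<close>. The fading contributes
  \<open>Gamma (2 / \<alpha> + 1)\<close>; in the uplink, channel inversion turns the moment of the power into the
  second moment \<open>1 / (pi * lam_B)\<close> of the distance, which cancels \<open>pi * lam_B\<close>.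
\<close>

section \<open>Poisson counts and products over the points\<close>

locale poisson_points = prob_space M
  for M :: "'w measure" +
  fixes lam :: real and X :: "nat \<Rightarrow> 'w \<Rightarrow> 'a :: euclidean_space"
  assumes poisson: "poisson_process M lam X"
begin

lemma measurable_points [measurable]: "X i \<in> borel_measurable M"
  using poisson by (simp add: poisson_process_def)

lemma sets_finite_count [measurable]:
  assumes [measurable]: "A \<in> sets borel"
  shows "{\<omega> \<in> space M. finite {i. X i \<omega> \<in> A}} \<in> events"
proof -
  \<comment> \<open>Bounding the indices expresses finiteness by countable quantifiers, which
    preserve measurability.\<close>
  have "finite {i. X i \<omega> \<in> A} \<longleftrightarrow> (\<exists>k. \<forall>i. X i \<omega> \<in> A \<longrightarrow> i < k)" for \<omega>
    by (auto simp: finite_nat_set_iff_bounded)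
  then show ?thesis by simp
qed

lemma measurable_count [measurable]:
  assumes "A \<in> sets borel" "bounded A"
  shows "(\<lambda>\<omega>. card {i. X i \<omega> \<in> A}) \<in> measurable M (count_space UNIV)"
proof -
  \<comment> \<open>Measurability of a count is not a separate clause of
    \<open>poisson_process\<close>; it is contained in independence, applied here to the family
    consisting of \<open>A\<close> alone.\<close>
  have "indep_vars (\<lambda>_. count_space UNIV) (\<lambda>j \<omega>. card {i. X i \<omega> \<in> (\<lambda>_::nat. A) j}) {..<Suc 0}"
    using poisson assms unfolding poisson_process_def
    by (elim conjE allE[where x="\<lambda>_. A"] allE[where x="Suc 0"]) (auto simp: disjoint_family_on_def)
  then show ?thesis by (auto simp: indep_vars_def)
qed

lemma prob_count:
  assumes "A \<in> sets borel" "bounded A"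
  shows "prob {\<omega> \<in> space M. finite {i. X i \<omega> \<in> A} \<and> card {i. X i \<omega> \<in> A} = n} =
          (lam * measure lborel A) ^ n / fact n * exp (- (lam * measure lborel A))"
  using poisson assms by (simp add: poisson_process_def)

text \<open>The sign comes from the void probability:
  \<open>exp (- (lam * measure lborel A))\<close> is at most 1.\<close>

lemma rate_nonneg:
  fixes A :: "'a set"
  assumes "A \<in> sets borel" "bounded A"
  shows "0 \<le> lam * measure lborel A"
  using prob_count[OF assms, of 0]
    prob_le_1[of "{\<omega> \<in> space M. finite {i. X i \<omega> \<in> A} \<and> card {i. X i \<omega> \<in> A} = 0}"] by simp

text \<open>The Poisson weights already sum to 1, so no mass is left for infinitely many points in
  \<open>A\<close>.\<close>

lemma AE_finite_count:
  assumes [measurable]: "A \<in> sets borel" and "bounded A"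
  shows "AE \<omega> in M. finite {i. X i \<omega> \<in> A}"
proof -
  note [measurable] = measurable_count[OF assms]
  define \<mu> where "\<mu> = lam * measure lborel A"
  define E where "E n = {\<omega> \<in> space M. finite {i. X i \<omega> \<in> A} \<and> card {i. X i \<omega> \<in> A} = n}" for n
  have E: "E n \<in> events" for n
    unfolding E_def by measurable
  have "(\<lambda>n. prob (E n)) sums prob (\<Union>n. E n)"
    by (rule finite_measure_UNION) (use E in \<open>auto simp: disjoint_family_on_def E_def\<close>)
  moreover have "(\<lambda>n. prob (E n)) sums 1"
  proof -
    have "(\<lambda>n. (\<mu> ^ n /\<^sub>R fact n) * exp (- \<mu>)) sums (exp \<mu> * exp (- \<mu>))"
      by (intro sums_mult2 exp_converges)
    then show ?thesis
      by (simp add: E_def \<mu>_def prob_count[OF assms] divide_inverse mult_ac flip: exp_add)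
  qed
  ultimately have "prob (\<Union>n. E n) = 1"
    by (rule sums_unique2)
  then have "AE \<omega> in M. \<omega> \<in> (\<Union>n. E n)"
    using E by (subst AE_in_set_eq_1) auto
  then show ?thesis
    by eventually_elim (auto simp: E_def)
qed

lemma distr_count:
  assumes [measurable]: "A \<in> sets borel" and "bounded A"
  shows "distr M (count_space UNIV) (\<lambda>\<omega>. card {i. X i \<omega> \<in> A}) =
    density (count_space UNIV)
      (\<lambda>n. ennreal ((lam * measure lborel A) ^ n / fact n * exp (- (lam * measure lborel A))))"
    (is "_ = density _ ?f")
proof (rule measure_eqI_countable)
  note [measurable] = measurable_count[OF assms]
  fix n :: nat
  have "emeasure (distr M (count_space UNIV) (\<lambda>\<omega>. card {i. X i \<omega> \<in> A})) {n} =
      emeasure M {\<omega> \<in> space M. card {i. X i \<omega> \<in> A} = n}"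
    by (subst emeasure_distr) (auto intro!: arg_cong[where f="emeasure M"])
  also have "\<dots> = emeasure M {\<omega> \<in> space M. finite {i. X i \<omega> \<in> A} \<and> card {i. X i \<omega> \<in> A} = n}"
    using AE_finite_count[OF assms] by (intro emeasure_eq_AE) auto
  also have "\<dots> = ?f n"
    by (simp only: prob_count[OF assms] emeasure_eq_measure)
  finally show "emeasure (distr M (count_space UNIV) (\<lambda>\<omega>. card {i. X i \<omega> \<in> A})) {n} =
      emeasure (density (count_space UNIV) ?f) {n}"
    by (simp add: emeasure_density nn_integral_count_space_indicator[symmetric]
        nn_integral_count_space_finite)
qed auto

text \<open>This is the probability generating function of the Poisson law, from the exponential
  series in \<open>\<mu> * u\<close>. It is applied with \<open>u = 1 - v j\<close> on each level
  set of a simple function.\<close>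

lemma nn_integral_power_count:
  assumes [measurable]: "A \<in> sets borel" and "bounded A" and u: "0 \<le> u"
  shows "(\<integral>\<^sup>+\<omega>. ennreal (u ^ card {i. X i \<omega> \<in> A}) \<partial>M) =
    ennreal (exp (- (lam * measure lborel A * (1 - u))))"
proof -
  note [measurable] = measurable_count[OF assms(1,2)]
  define \<mu> where "\<mu> = lam * measure lborel A"
  have \<mu>: "0 \<le> \<mu>" unfolding \<mu>_def by (rule rate_nonneg[OF assms(1,2)])
  have "(\<integral>\<^sup>+\<omega>. ennreal (u ^ card {i. X i \<omega> \<in> A}) \<partial>M) =
      (\<integral>\<^sup>+n. ennreal (u ^ n) \<partial>distr M (count_space UNIV) (\<lambda>\<omega>. card {i. X i \<omega> \<in> A}))"
    by (subst nn_integral_distr) auto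
  also have "\<dots> = (\<integral>\<^sup>+n. ennreal (\<mu> ^ n / fact n * exp (- \<mu>)) * ennreal (u ^ n) \<partial>count_space UNIV)"
    unfolding distr_count[OF assms(1,2)] \<mu>_def by (subst nn_integral_density) auto
  also have "\<dots> = (\<Sum>n. ennreal (((\<mu> * u) ^ n /\<^sub>R fact n) * exp (- \<mu>)))"
    using \<mu> u by (simp add: nn_integral_count_space_nat power_mult_distrib field_simps
        flip: ennreal_mult)
  also have "\<dots> = ennreal (exp (\<mu> * u) * exp (- \<mu>))"
    using \<mu> u by (intro suminf_ennreal_eq sums_mult2 exp_converges) auto
  also have "exp (\<mu> * u) * exp (- \<mu>) = exp (- (\<mu> * (1 - u)))"
    by (simp add: algebra_simps flip: exp_add)
  finally show ?thesis by (simp add: \<mu>_def)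
qed

text \<open>The level sets of a simple function carry independent Poisson counts, and the infinite
  product below is almost surely a finite one.\<close>

lemma nn_integral_prod_simple:
  fixes s :: "'a \<Rightarrow> real"
  assumes s: "simple_function borel s" and s01: "\<And>x. 0 \<le> s x" "\<And>x. s x \<le> 1"
    and S: "bounded S" "\<And>x. s x \<noteq> 0 \<Longrightarrow> x \<in> S"
  shows "(\<integral>\<^sup>+\<omega>. (INF k. ennreal (\<Prod>i<k. 1 - s (X i \<omega>))) \<partial>M) =
    ennreal (exp (- (lam * (\<integral>x. s x \<partial>lborel))))"
proof -
  \<comment> \<open>The value 0 is left out: its factor is 1, and its level set contains the
    complement of \<open>S\<close>, hence is unbounded, whereas Poisson counts are given for bounded
    sets.\<close>
  define V where "V = range s - {0}"
  have "finite V"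
    using simple_functionD(1)[OF s] by (simp add: V_def)
  then obtain v where v: "bij_betw v {..<card V} V"
    using ex_bij_betw_nat_finite[of V] by (auto simp: atLeast0LessThan)
  define A where "A j = s -` {v j}" for j
  have A[measurable]: "A j \<in> sets borel" for j
    using simple_functionD(2)[OF s, of "{v j}"] by (simp add: A_def)
  have v_V: "v j \<in> V" if "j < card V" for j
    using v that by (auto simp: bij_betw_def)
  have v01: "0 \<le> v j" "v j \<le> 1" if "j < card V" for j
    using v_V[OF that] s01 by (auto simp: V_def)
  have bA: "bounded (A j)" if "j < card V" for j
    using v_V[OF that] S(2) by (intro bounded_subset[OF S(1)]) (auto simp: A_def V_def)
  have disj: "disjoint_family_on A {..<card V}"
    using v unfolding disjoint_family_on_def A_def bij_betw_def inj_on_def by auto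
  have cover: "\<exists>j<card V. x \<in> A j" if "s x \<noteq> 0" for x
  proof -
    have "s x \<in> v ` {..<card V}"
      using v that by (auto simp: bij_betw_def V_def)
    then show ?thesis by (auto simp: A_def)
  qed
  have "(\<integral>\<^sup>+\<omega>. (INF k. ennreal (\<Prod>i<k. 1 - s (X i \<omega>))) \<partial>M) =
      (\<integral>\<^sup>+\<omega>. (\<Prod>j<card V. ennreal ((1 - v j) ^ card {i. X i \<omega> \<in> A j})) \<partial>M)"
  proof (rule nn_integral_cong_AE)
    have "AE \<omega> in M. \<forall>j\<in>{..<card V}. finite {i. X i \<omega> \<in> A j}"
      by (intro AE_finite_allI AE_finite_count A bA) auto
    then show "AE \<omega> in M. (INF k. ennreal (\<Prod>i<k. 1 - s (X i \<omega>))) =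
        (\<Prod>j<card V. ennreal ((1 - v j) ^ card {i. X i \<omega> \<in> A j}))"
    proof eventually_elim
      case (elim \<omega>)
      define F where "F j = {i. X i \<omega> \<in> A j}" for j
      have finF: "finite (F j)" if "j < card V" for j
        using elim that by (simp add: F_def)
      define U where "U = (\<Union>j<card V. F j)"
      have finU: "finite U"
        using finF by (simp add: U_def)
      then obtain K where K: "U \<subseteq> {..<K}"
        using finite_nat_iff_bounded by blast
      have s0: "s (X i \<omega>) = 0" if "i \<notin> U" for i
        using cover[of "X i \<omega>"] that by (auto simp: U_def F_def)
      \<comment> \<open>Indices outside \<open>U\<close> contribute factors 1, so the decreasing
        partial products are constant from \<open>K\<close> on, and their infimum is the product
        over \<open>U\<close>.\<close>
      have eq: "(\<Prod>i<k. 1 - s (X i \<omega>)) = (\<Prod>i\<in>U. 1 - s (X i \<omega>))" if "K \<le> k" for k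
        using K that finU s0 by (intro prod.mono_neutral_right) auto
      have anti: "antimono (\<lambda>k. ennreal (\<Prod>i<k. 1 - s (X i \<omega>)))"
        unfolding decseq_Suc_iff using s01
        by (auto intro!: ennreal_leI mult_left_le prod_nonneg)
      have "(INF k. ennreal (\<Prod>i<k. 1 - s (X i \<omega>))) = ennreal (\<Prod>i\<in>U. 1 - s (X i \<omega>))"
      proof (rule LIMSEQ_unique[OF LIMSEQ_INF[OF anti]])
        show "(\<lambda>k. ennreal (\<Prod>i<k. 1 - s (X i \<omega>))) \<longlonglongrightarrow> ennreal (\<Prod>i\<in>U. 1 - s (X i \<omega>))"
          by (rule tendsto_eventually) (auto simp: eventually_sequentially eq intro!: exI[of _ K])
      qed
      also have "(\<Prod>i\<in>U. 1 - s (X i \<omega>)) = (\<Prod>j<card V. \<Prod>i\<in>F j. 1 - s (X i \<omega>))"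
        unfolding U_def
      proof (rule prod.UNION_disjoint)
        show "\<forall>i\<in>{..<card V}. \<forall>j\<in>{..<card V}. i \<noteq> j \<longrightarrow> F i \<inter> F j = {}"
          using disj by (fastforce simp: F_def disjoint_family_on_def)
      qed (use finF in auto)
      also have "\<dots> = (\<Prod>j<card V. (1 - v j) ^ card (F j))"
      proof (rule prod.cong[OF refl])
        fix j
        have "(\<Prod>i\<in>F j. 1 - s (X i \<omega>)) = (\<Prod>i\<in>F j. 1 - v j)"
          by (rule prod.cong) (auto simp: F_def A_def)
        then show "(\<Prod>i\<in>F j. 1 - s (X i \<omega>)) = (1 - v j) ^ card (F j)" by simp
      qed
      finally show ?case
        using v01 by (subst prod_ennreal) (auto simp: F_def)
    qed
  qed
  also have "\<dots> = (\<Prod>j<card V. \<integral>\<^sup>+\<omega>. ennreal ((1 - v j) ^ card {i. X i \<omega> \<in> A j}) \<partial>M)"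
  proof (rule indep_vars_nn_integral)
    have "indep_vars (\<lambda>_. count_space UNIV) (\<lambda>j \<omega>. card {i. X i \<omega> \<in> A j}) {..<card V}"
      using poisson bA disj unfolding poisson_process_def by auto
    then show "indep_vars (\<lambda>_. borel) (\<lambda>j \<omega>. ennreal ((1 - v j) ^ card {i. X i \<omega> \<in> A j})) {..<card V}"
      by (rule indep_vars_compose2) auto
  qed auto
  also have "\<dots> = (\<Prod>j<card V. ennreal (exp (- (lam * measure lborel (A j) * v j))))"
  proof (rule prod.cong[OF refl])
    fix j assume "j \<in> {..<card V}"
    then show "(\<integral>\<^sup>+\<omega>. ennreal ((1 - v j) ^ card {i. X i \<omega> \<in> A j}) \<partial>M) =
        ennreal (exp (- (lam * measure lborel (A j) * v j)))"
      using nn_integral_power_count[OF A bA, of j "1 - v j"] v01[of j] by simp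
  qed
  also have "\<dots> = ennreal (exp (- (lam * (\<Sum>j<card V. v j * measure lborel (A j)))))"
    by (simp add: prod_ennreal exp_sum[symmetric] sum_negf sum_distrib_left mult_ac)
  also have "(\<Sum>j<card V. v j * measure lborel (A j)) =
      (\<integral>x. (\<Sum>j<card V. v j * indicator (A j) x) \<partial>lborel)"
    using emeasure_bounded_finite[OF bA] by (subst Bochner_Integration.integral_sum) auto
  \<comment> \<open>At each \<open>x\<close> only the term with value \<open>s x\<close> survives;
    if \<open>s x\<close> is 0, none does, in accordance with the value omitted from
    \<open>V\<close>.\<close>
  also have "(\<lambda>x. \<Sum>j<card V. v j * indicator (A j) x) = s"
  proof
    fix x
    have "(\<Sum>j<card V. v j * indicator (A j) x) = (\<Sum>j<card V. if s x = v j then v j else 0)"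
      by (intro sum.cong) (auto simp: A_def)
    also have "\<dots> = (\<Sum>y\<in>V. if s x = y then y else 0)"
      by (rule sum.reindex_bij_betw[OF v])
    also have "\<dots> = s x"
      using \<open>finite V\<close> by (auto simp: V_def sum.delta)
    finally show "(\<Sum>j<card V. v j * indicator (A j) x) = s x" .
  qed
  finally show ?thesis by simp
qed

text \<open>Simple functions of bounded support increase to \<open>v\<close>, so the products
  decrease, and monotone convergence from above applies because they are bounded by 1 on a
  probability space. The exponents converge by dominated convergence with \<open>v\<close> itself as
  the bound.\<close>

lemma nn_integral_prod:
  fixes v :: "'a \<Rightarrow> real"
  assumes v[measurable]: "v \<in> borel_measurable borel" and v01: "\<And>x. 0 \<le> v x" "\<And>x. v x \<le> 1"
    and int: "integrable lborel v"
  shows "(\<integral>\<^sup>+\<omega>. (INF k. ennreal (\<Prod>i<k. 1 - v (X i \<omega>))) \<partial>M) =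
    ennreal (exp (- (lam * (\<integral>x. v x \<partial>lborel))))"
proof -
  obtain f where f: "\<And>n. simple_function borel (f n)" "incseq f"
      "\<And>x. bdd_above (range (\<lambda>n. f n x))" "\<And>n x. 0 \<le> f n x" "v = (SUP n. f n)"
    using borel_measurable_implies_simple_function_sequence_real[OF v v01(1)] by blast
  \<comment> \<open>Cutting off at growing balls gives the bounded support required in the simple
    case and keeps the sequence increasing, since \<open>f\<close> is nonnegative.\<close>
  define s where "s n x = f n x * indicator (cball 0 (real n)) x" for n x
  have s_simple: "simple_function borel (s n)" for n
    unfolding s_def by (intro simple_function_mult f simple_function_indicator) auto
  then have s_meas[measurable]: "s n \<in> borel_measurable borel" for n
    by (rule borel_measurable_simple_function)
  have f_lim: "(\<lambda>n. f n x) \<longlonglongrightarrow> v x" for x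
  proof -
    have "(\<lambda>n. f n x) \<longlonglongrightarrow> (SUP n. f n x)"
      using f(2,3) by (intro LIMSEQ_incseq_SUP) (auto simp: incseq_def le_fun_def)
    also have "(SUP n. f n x) = v x"
      by (simp add: f(5) image_image)
    finally show ?thesis .
  qed
  have f_le: "f n x \<le> v x" for n x
    using f(2) by (intro incseq_le[OF _ f_lim]) (auto simp: incseq_def le_fun_def)
  have s_nonneg: "0 \<le> s n x" for n x
    using f(4) by (simp add: s_def)
  have s_le: "s n x \<le> v x" for n x
    using f_le[of n x] v01(1)[of x] by (simp add: s_def indicator_def)
  have s_mono: "s n x \<le> s (Suc n) x" for n x
    using f(2,4) by (auto simp: s_def indicator_def incseq_Suc_iff le_fun_def)
  have s_lim: "(\<lambda>n. s n x) \<longlonglongrightarrow> v x" for x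
  proof -
    obtain N :: nat where N: "norm x \<le> real N" using real_arch_simple by blast
    have "\<forall>\<^sub>F n in sequentially. f n x = s n x"
      using eventually_ge_at_top[of N] by eventually_elim (use N in \<open>auto simp: s_def indicator_def\<close>)
    then show ?thesis by (rule Lim_transform_eventually[OF f_lim])
  qed
  define D where "D n k \<omega> = ennreal (\<Prod>i<k. 1 - s n (X i \<omega>))" for n k \<omega>
  have D_meas[measurable]: "D n k \<in> borel_measurable M" for n k
    unfolding D_def by measurable
  have D_mono: "D (Suc n) k \<omega> \<le> D n k \<omega>" for n k \<omega>
    unfolding D_def using s_mono order_trans[OF s_le v01(2)]
    by (intro ennreal_leI prod_mono) auto
  have D_inf: "(INF n. D n k \<omega>) = ennreal (\<Prod>i<k. 1 - v (X i \<omega>))" for k \<omega>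
  proof (rule LIMSEQ_unique)
    show "(\<lambda>n. D n k \<omega>) \<longlonglongrightarrow> (INF n. D n k \<omega>)"
      using D_mono by (intro LIMSEQ_INF) (auto simp: decseq_Suc_iff)
    show "(\<lambda>n. D n k \<omega>) \<longlonglongrightarrow> ennreal (\<Prod>i<k. 1 - v (X i \<omega>))"
      unfolding D_def by (intro tendsto_ennrealI tendsto_prod tendsto_diff tendsto_const s_lim)
  qed
  have "(\<integral>\<^sup>+\<omega>. (INF k. ennreal (\<Prod>i<k. 1 - v (X i \<omega>))) \<partial>M) =
      (\<integral>\<^sup>+\<omega>. (INF k. INF n. D n k \<omega>) \<partial>M)"
    by (simp add: D_inf)
  \<comment> \<open>Infima commute, so the infinite product can be formed first for each fixed
    approximation \<open>n\<close>, where its expectation is known.\<close>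
  also have "\<dots> = (\<integral>\<^sup>+\<omega>. (INF n. INF k. D n k \<omega>) \<partial>M)"
    by (subst INF_commute) simp
  also have "\<dots> = (INF n. \<integral>\<^sup>+\<omega>. (INF k. D n k \<omega>) \<partial>M)"
  proof (rule nn_integral_monotone_convergence_INF_decseq)
    show "decseq (\<lambda>n \<omega>. INF k. D n k \<omega>)"
      by (intro decseq_SucI le_funI INF_mono' D_mono)
    have "(\<integral>\<^sup>+\<omega>. (INF k. D 0 k \<omega>) \<partial>M) \<le> (\<integral>\<^sup>+\<omega>. 1 \<partial>M)"
      by (intro nn_integral_mono INF_lower2[of 0]) (auto simp: D_def)
    then show "(\<integral>\<^sup>+\<omega>. (INF k. D 0 k \<omega>) \<partial>M) < \<infinity>"
      by (simp add: emeasure_space_1 le_less_trans)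
  qed measurable
  also have "\<dots> = ennreal (exp (- (lam * (\<integral>x. v x \<partial>lborel))))"
  proof (rule LIMSEQ_unique)
    show "(\<lambda>n. \<integral>\<^sup>+\<omega>. (INF k. D n k \<omega>) \<partial>M) \<longlonglongrightarrow> (INF n. \<integral>\<^sup>+\<omega>. (INF k. D n k \<omega>) \<partial>M)"
      by (intro LIMSEQ_INF) (auto simp: decseq_Suc_iff intro!: nn_integral_mono INF_mono' D_mono)
    have "(\<integral>\<^sup>+\<omega>. (INF k. D n k \<omega>) \<partial>M) = ennreal (exp (- (lam * (\<integral>x. s n x \<partial>lborel))))" for n
      unfolding D_def
      by (rule nn_integral_prod_simple[OF s_simple s_nonneg order_trans[OF s_le v01(2)], of "cball 0 (real n)"])
         (auto simp: s_def split: split_indicator_asm)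
    moreover have "(\<lambda>n. \<integral>x. s n x \<partial>lborel) \<longlonglongrightarrow> (\<integral>x. v x \<partial>lborel)"
      by (rule integral_dominated_convergence[where w=v])
         (use int s_lim s_le s_nonneg in \<open>auto simp: abs_of_nonneg\<close>)
    ultimately show "(\<lambda>n. \<integral>\<^sup>+\<omega>. (INF k. D n k \<omega>) \<partial>M) \<longlonglongrightarrow>
        ennreal (exp (- (lam * (\<integral>x. v x \<partial>lborel))))"
      by (auto intro!: tendsto_ennrealI tendsto_intros)
  qed
  finally show ?thesis .
qed

end

section \<open>Independent marks\<close>

locale marked_poisson_points = poisson_points M lam X
  for M :: "'w measure" and lam :: real and X :: "nat \<Rightarrow> 'w \<Rightarrow> 'a :: euclidean_space" +
  fixes Q :: "'m measure" and Z :: "nat \<Rightarrow> 'w \<Rightarrow> 'm"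
  assumes marks: "independent_marks M X Q Z"
begin

lemma indep_marks: "indep_vars (\<lambda>_. Q) Z UNIV"
  using marks by (simp add: independent_marks_def)

lemma measurable_marks [measurable]: "Z i \<in> measurable M Q"
  using indep_marks by (auto simp: indep_vars_def)

lemma distr_mark: "distr M Q (Z i) = Q"
  using marks by (simp add: independent_marks_def)

lemma prob_space_mark_law: "prob_space Q"
  using prob_space_distr[OF measurable_marks] by (simp add: distr_mark)

lemma measurable_point_seq: "(\<lambda>\<omega> i. X i \<omega>) \<in> measurable M (Pi\<^sub>M UNIV (\<lambda>_. borel))"
  by (intro measurable_PiM_single') auto

lemma measurable_mark_seq: "(\<lambda>\<omega> i. Z i \<omega>) \<in> measurable M (Pi\<^sub>M UNIV (\<lambda>_. Q))"
  by (intro measurable_PiM_single') (auto dest: measurable_space[OF measurable_marks])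

text \<open>Independence is given between generated sigma-algebras. Read on rectangles, it says that
  the joint law is a product, the form to which Fubini applies.\<close>

lemma distr_points_marks:
  "distr M (Pi\<^sub>M UNIV (\<lambda>_. borel)) (\<lambda>\<omega> i. X i \<omega>) \<Otimes>\<^sub>M distr M (Pi\<^sub>M UNIV (\<lambda>_. Q)) (\<lambda>\<omega> i. Z i \<omega>) =
    distr M (Pi\<^sub>M UNIV (\<lambda>_. borel) \<Otimes>\<^sub>M Pi\<^sub>M UNIV (\<lambda>_. Q)) (\<lambda>\<omega>. (\<lambda>i. X i \<omega>, \<lambda>i. Z i \<omega>))"
  (is "?LX \<Otimes>\<^sub>M ?LZ = ?L")
proof (rule pair_measure_eqI)
  note [measurable] = measurable_point_seq measurable_mark_seq
  show "sigma_finite_measure ?LX" "sigma_finite_measure ?LZ"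
    by (auto intro!: prob_space_imp_sigma_finite prob_space_distr)
  fix A B assume AB: "A \<in> sets ?LX" "B \<in> sets ?LZ"
  let ?a = "(\<lambda>\<omega> i. X i \<omega>) -` A \<inter> space M" and ?b = "(\<lambda>\<omega> i. Z i \<omega>) -` B \<inter> space M"
  have "prob (?a \<inter> ?b) = prob ?a * prob ?b"
  proof (rule indep_setD)
    show "indep_set (sets (vimage_algebra (space M) (\<lambda>\<omega> i. X i \<omega>) (Pi\<^sub>M UNIV (\<lambda>_. borel))))
       (sets (vimage_algebra (space M) (\<lambda>\<omega> i. Z i \<omega>) (Pi\<^sub>M UNIV (\<lambda>_. Q))))"
      using marks by (simp add: independent_marks_def)
  qed (use AB in \<open>auto intro!: in_vimage_algebra\<close>)
  moreover have "?a \<inter> ?b = (\<lambda>\<omega>. (\<lambda>i. X i \<omega>, \<lambda>i. Z i \<omega>)) -` (A \<times> B) \<inter> space M"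
    by auto
  ultimately show "emeasure ?LX A * emeasure ?LZ B = emeasure ?L (A \<times> B)"
    using AB by (simp add: emeasure_distr emeasure_eq_measure ennreal_mult)
qed (simp cong: sets_pair_measure_cong)

lemma emeasure_marks_below:
  assumes B: "\<And>i. i < k \<Longrightarrow> B i \<in> sets Q"
  shows "emeasure M {\<omega> \<in> space M. \<forall>i<k. Z i \<omega> \<in> B i} = (\<Prod>i<k. emeasure Q (B i))"
\<comment> \<open>For \<open>k = 0\<close> the intersection used below would be the whole type
  rather than \<open>space M\<close>, and the product rule for independent variables asks for a
  nonempty index set.\<close>
proof (cases "k = 0")
  case True
  then show ?thesis by (simp add: emeasure_space_1)
next
  case False
  have eq: "prob (Z i -` B i \<inter> space M) = measure Q (B i)" if "i < k" for i
    using measure_distr[OF measurable_marks B[OF that], of i] by (simp add: distr_mark)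
  have "{\<omega> \<in> space M. \<forall>i<k. Z i \<omega> \<in> B i} = (\<Inter>i\<in>{..<k}. Z i -` B i \<inter> space M)"
    using False by auto
  also have "prob \<dots> = (\<Prod>i<k. prob (Z i -` B i \<inter> space M))"
    by (rule indep_varsD_finite[OF indep_vars_subset[OF indep_marks]]) (use False B in auto)
  also have "\<dots> = (\<Prod>i<k. measure Q (B i))"
    by (rule prod.cong) (auto simp: eq)
  finally show ?thesis
    using prob_space.finite_measure[OF prob_space_mark_law]
    by (simp add: emeasure_eq_measure finite_measure.emeasure_eq_measure prod_ennreal)
qed

text \<open>Conditioning on the points becomes Fubini on the product law: with the point sequence
  frozen, the marks are still independent with law \<open>Q\<close>, so the conditional probability
  is a product. Restriction to \<open>i < k\<close> keeps this product finite.\<close>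

lemma emeasure_marked_below:
  assumes R[measurable]: "Measurable.pred (borel \<Otimes>\<^sub>M Q) R"
  shows "emeasure M {\<omega> \<in> space M. \<forall>i<k. R (X i \<omega>, Z i \<omega>)} =
    (\<integral>\<^sup>+\<omega>. (\<Prod>i<k. emeasure Q {z \<in> space Q. R (X i \<omega>, z)}) \<partial>M)"
proof -
  interpret Q: prob_space Q by (rule prob_space_mark_law)
  define BX where "BX = Pi\<^sub>M (UNIV :: nat set) (\<lambda>_. borel :: 'a measure)"
  define BZ where "BZ = Pi\<^sub>M (UNIV :: nat set) (\<lambda>_. Q)"
  define LX where "LX = distr M BX (\<lambda>\<omega> i. X i \<omega>)"
  define LZ where "LZ = distr M BZ (\<lambda>\<omega> i. Z i \<omega>)"
  have X_meas[measurable]: "(\<lambda>\<omega> i. X i \<omega>) \<in> measurable M BX"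
    unfolding BX_def by (rule measurable_point_seq)
  have Z_meas[measurable]: "(\<lambda>\<omega> i. Z i \<omega>) \<in> measurable M BZ"
    unfolding BZ_def by (rule measurable_mark_seq)
  interpret LX: prob_space LX unfolding LX_def by (rule prob_space_distr[OF X_meas])
  interpret LZ: prob_space LZ unfolding LZ_def by (rule prob_space_distr[OF Z_meas])
  have [measurable_cong]: "sets LX = sets BX" "sets LZ = sets BZ"
    by (simp_all add: LX_def LZ_def)
  have spZ: "space LZ = space BZ" "space LX = UNIV"
    by (simp_all add: LZ_def LX_def BX_def space_PiM)
  have cX[measurable]: "(\<lambda>x. x i) \<in> measurable BX borel" for i
    unfolding BX_def by simp
  have cZ[measurable]: "(\<lambda>z. z i) \<in> measurable BZ Q" for i
    unfolding BZ_def by simp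
  define E where "E = {p \<in> space (BX \<Otimes>\<^sub>M BZ). \<forall>i<k. R (fst p i, snd p i)}"
  have E[measurable]: "E \<in> sets (BX \<Otimes>\<^sub>M BZ)"
    unfolding E_def by measurable
  have "{\<omega> \<in> space M. \<forall>i<k. R (X i \<omega>, Z i \<omega>)} =
      (\<lambda>\<omega>. (\<lambda>i. X i \<omega>, \<lambda>i. Z i \<omega>)) -` E \<inter> space M"
    using measurable_space[OF X_meas] measurable_space[OF Z_meas]
    by (auto simp: E_def space_pair_measure)
  also have "emeasure M \<dots> = emeasure (LX \<Otimes>\<^sub>M LZ) E"
    unfolding LX_def LZ_def BX_def BZ_def distr_points_marks unfolding BX_def[symmetric] BZ_def[symmetric]
    by (rule emeasure_distr[symmetric]) measurable
  also have "\<dots> = (\<integral>\<^sup>+x. emeasure LZ (Pair x -` E) \<partial>LX)"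
    by (rule LZ.emeasure_pair_measure_alt) simp
  also have "\<dots> = (\<integral>\<^sup>+x. (\<Prod>i<k. emeasure Q {z \<in> space Q. R (x i, z)}) \<partial>LX)"
  proof (rule nn_integral_cong)
    fix x
    \<comment> \<open>The section at \<open>x\<close> constrains the first \<open>k\<close> marks
      only, each by a deterministic set.\<close>
    have "emeasure LZ (Pair x -` E) = emeasure M {\<omega> \<in> space M. \<forall>i<k. Z i \<omega> \<in> {z \<in> space Q. R (x i, z)}}"
      unfolding LZ_def
      by (subst emeasure_distr, simp_all)
         (auto intro!: arg_cong[where f="emeasure M"] dest: measurable_space[OF Z_meas] measurable_space[OF measurable_marks]
           simp: E_def space_pair_measure BX_def space_PiM)
    also have "\<dots> = (\<Prod>i<k. emeasure Q {z \<in> space Q. R (x i, z)})"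
      by (rule emeasure_marks_below) measurable
    finally show "emeasure LZ (Pair x -` E) = (\<Prod>i<k. emeasure Q {z \<in> space Q. R (x i, z)})" .
  qed
  also have "\<dots> = (\<integral>\<^sup>+\<omega>. (\<Prod>i<k. emeasure Q {z \<in> space Q. R (X i \<omega>, z)}) \<partial>M)"
    unfolding LX_def by (subst nn_integral_distr) (auto intro!: borel_measurable_prod_ennreal)
  finally show ?thesis .
qed

text \<open>Here \<open>v x\<close> is the probability that a point at \<open>x\<close> violates
  \<open>R\<close>. As \<open>k\<close> grows, both the events and the products decrease, so
  continuity from above turns the finite formula into the void probability of the process thinned by
  \<open>v\<close>.\<close>

lemma prob_all_marked:
  fixes R
  defines "v \<equiv> \<lambda>x. measure Q {z \<in> space Q. \<not> R (x, z)}"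
  assumes R[measurable]: "Measurable.pred (borel \<Otimes>\<^sub>M Q) R" and int: "integrable lborel v"
  shows "prob {\<omega> \<in> space M. \<forall>i. R (X i \<omega>, Z i \<omega>)} = exp (- (lam * (\<integral>x. v x \<partial>lborel)))"
proof -
  interpret Q: prob_space Q by (rule prob_space_mark_law)
  define E where "E k = {\<omega> \<in> space M. \<forall>i<k. R (X i \<omega>, Z i \<omega>)}" for k
  define D where "D k \<omega> = ennreal (\<Prod>i<k. 1 - v (X i \<omega>))" for k \<omega>
  have E[measurable]: "E k \<in> events" for k
    unfolding E_def by measurable
  have v_meas[measurable]: "v \<in> borel_measurable borel"
    using int by auto
  have v01: "0 \<le> v x" "v x \<le> 1" for x
    by (auto simp: v_def)
  have compl: "emeasure Q {z \<in> space Q. R (x, z)} = ennreal (1 - v x)" for x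
  proof -
    have "{z \<in> space Q. R (x, z)} = space Q - {z \<in> space Q. \<not> R (x, z)}" by auto
    then show ?thesis
      by (simp add: Q.emeasure_eq_measure v_def Q.prob_compl)
  qed
  have D_meas: "D k \<in> borel_measurable M" for k
    unfolding D_def by measurable
  have emE: "emeasure M (E k) = (\<integral>\<^sup>+\<omega>. D k \<omega> \<partial>M)" for k
    unfolding E_def emeasure_marked_below[OF R] compl D_def using v01
    by (simp add: prod_ennreal)
  have "{\<omega> \<in> space M. \<forall>i. R (X i \<omega>, Z i \<omega>)} = (\<Inter>k. E k)"
    by (auto simp: E_def)
  also have "emeasure M \<dots> = (INF k. emeasure M (E k))"
    by (rule INF_emeasure_decseq[symmetric]) (auto simp: E_def decseq_def)
  also have "\<dots> = (\<integral>\<^sup>+\<omega>. (INF k. D k \<omega>) \<partial>M)"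
    unfolding emE
  proof (rule nn_integral_monotone_convergence_INF_decseq[symmetric])
    show "decseq D"
      using v01 by (intro decseq_SucI le_funI) (auto simp: D_def intro!: ennreal_leI mult_left_le prod_nonneg)
    show "(\<integral>\<^sup>+\<omega>. D 0 \<omega> \<partial>M) < \<infinity>"
      by (simp add: D_def emeasure_space_1)
  qed (rule D_meas)
  also have "\<dots> = ennreal (exp (- (lam * (\<integral>x. v x \<partial>lborel))))"
    unfolding D_def by (rule nn_integral_prod[OF v_meas v01 int])
  finally show ?thesis
    by (simp add: emeasure_eq_measure)
qed

end

section \<open>Sensing region and probability of no strong signal\<close>

lemma emeasure_sensing_region:
  assumes "\<gamma> > 0" "\<alpha> > 0"
  shows "emeasure lborel {x :: real ^ 2. \<gamma> < s * norm x powr (- \<alpha>)} =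
    ennreal (pi * (max 0 s / \<gamma>) powr (2 / \<alpha>))"
proof (cases "s > 0")
  case True
  \<comment> \<open>This is the distance at which the received strength equals the
    threshold.\<close>
  define r where "r = (s / \<gamma>) powr (1 / \<alpha>)"
  have r: "r > 0" "r powr \<alpha> = s / \<gamma>"
    using True assms by (auto simp: r_def powr_powr)
  have iff: "\<gamma> < s * y powr (- \<alpha>) \<longleftrightarrow> y < r" if "y > 0" for y :: real
  proof -
    have "\<gamma> < s * y powr (- \<alpha>) \<longleftrightarrow> y powr \<alpha> < r powr \<alpha>"
      using that assms by (simp add: r(2) powr_minus field_simps)
    also have "\<dots> \<longleftrightarrow> y < r"
      using that r(1) assms by (auto intro: powr_less_mono2 dest: powr_less_cancel2[rotated -1])
    finally show ?thesis .
  qed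
  \<comment> \<open>The origin is excluded because \<open>0 powr (- \<alpha>)\<close> is 0; a single
    point does not affect the area.\<close>
  have "{x :: real ^ 2. \<gamma> < s * norm x powr (- \<alpha>)} = ball 0 r - {0}"
  proof (intro set_eqI)
    fix x :: "real ^ 2"
    show "x \<in> {x. \<gamma> < s * norm x powr (- \<alpha>)} \<longleftrightarrow> x \<in> ball 0 r - {0}"
      using iff[of "norm x"] assms by (cases "x = 0") auto
  qed
  also have "emeasure lborel \<dots> = ennreal (pi * r\<^sup>2)"
    using r(1) by (subst emeasure_Diff_null_set) (auto simp: emeasure_ball unit_ball_vol_2)
  also have "r\<^sup>2 = (max 0 s / \<gamma>) powr (2 / \<alpha>)"
    using True assms by (simp add: r_def powr_powr flip: powr_numeral)
  finally show ?thesis .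
next
  case False
  then have "s * norm x powr (- \<alpha>) \<le> 0" for x :: "real ^ 2"
    by (simp add: mult_nonpos_nonneg)
  from this[THEN order_trans] have "{x :: real ^ 2. \<gamma> < s * norm x powr (- \<alpha>)} = {}"
    using assms by (auto simp: not_less)
  then show ?thesis using False by simp
qed

text \<open>A mark \<open>z\<close> enters only through \<open>s z\<close>, the received strength at
  unit distance, so both kinds of link are instances. The moment hypothesis yields the integrability
  of \<open>v\<close> as well as its integral.\<close>

lemma prob_no_strong_signal:
  fixes X :: "nat \<Rightarrow> 'w \<Rightarrow> real ^ 2"
  assumes "marked_poisson_points M lam X Q Z" and s[measurable]: "s \<in> borel_measurable Q"
    and pos: "\<gamma> > 0" "\<alpha> > 0" "c \<ge> 0"
    and moment: "(\<integral>\<^sup>+z. ennreal ((max 0 (s z) / \<gamma>) powr (2 / \<alpha>)) \<partial>Q) = ennreal c"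
  shows "measure M {\<omega> \<in> space M. \<not> (\<exists>i. s (Z i \<omega>) * norm (X i \<omega>) powr (- \<alpha>) > \<gamma>)} =
    exp (- (lam * (pi * c)))"
proof -
  interpret marked_poisson_points M lam X Q Z by fact
  interpret Q: prob_space Q by (rule prob_space_mark_law)
  interpret pair_sigma_finite lborel Q ..
  define R where "R p \<longleftrightarrow> \<not> \<gamma> < s (snd p) * norm (fst p) powr (- \<alpha>)" for p :: "(real ^ 2) \<times> _"
  have R[measurable]: "Measurable.pred (borel \<Otimes>\<^sub>M Q) R"
    unfolding R_def by measurable
  define v where "v x = measure Q {z \<in> space Q. \<not> R (x, z)}" for x
  have v_meas[measurable]: "v \<in> borel_measurable borel"
  proof -
    \<comment> \<open>\<open>v x\<close> is the measure of a section of a measurable set, hence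
      measurable in \<open>x\<close>.\<close>
    have "{p \<in> space (borel \<Otimes>\<^sub>M Q). \<not> R p} \<in> sets (borel \<Otimes>\<^sub>M Q)" by measurable
    from Q.measurable_emeasure_Pair[OF this]
    have "(\<lambda>x. enn2real (emeasure Q (Pair x -` {p \<in> space (borel \<Otimes>\<^sub>M Q). \<not> R p}))) \<in> borel_measurable borel"
      by measurable
    moreover have "Pair x -` {p \<in> space (borel \<Otimes>\<^sub>M Q). \<not> R p} = {z \<in> space Q. \<not> R (x, z)}" for x
      by (auto simp: space_pair_measure)
    ultimately show ?thesis
      by (simp add: v_def[abs_def] measure_def)
  qed
  have "(\<integral>\<^sup>+x. ennreal (v x) \<partial>lborel) =
      (\<integral>\<^sup>+x. \<integral>\<^sup>+z. indicator {p. \<not> R p} (x, z) \<partial>Q \<partial>lborel)"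
  proof (rule nn_integral_cong)
    fix x
    have "(\<integral>\<^sup>+z. indicator {p. \<not> R p} (x, z) \<partial>Q) = (\<integral>\<^sup>+z. indicator {z \<in> space Q. \<not> R (x, z)} z \<partial>Q)"
      by (rule nn_integral_cong) (simp add: indicator_def)
    then show "ennreal (v x) = (\<integral>\<^sup>+z. indicator {p. \<not> R p} (x, z) \<partial>Q)"
      by (simp add: v_def Q.emeasure_eq_measure)
  qed
  also have "\<dots> = (\<integral>\<^sup>+z. \<integral>\<^sup>+x. indicator {p. \<not> R p} (x, z) \<partial>lborel \<partial>Q)"
    by (rule Fubini'[symmetric]) measurable
  also have "\<dots> = (\<integral>\<^sup>+z. emeasure lborel {x :: real ^ 2. \<gamma> < s z * norm x powr (- \<alpha>)} \<partial>Q)"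
  proof (rule nn_integral_cong)
    fix z
    have "(\<integral>\<^sup>+x. indicator {p. \<not> R p} (x, z) \<partial>lborel) =
        (\<integral>\<^sup>+x. indicator {x :: real ^ 2. \<gamma> < s z * norm x powr (- \<alpha>)} x \<partial>lborel)"
      by (rule nn_integral_cong) (simp add: indicator_def R_def)
    then show "(\<integral>\<^sup>+x. indicator {p. \<not> R p} (x, z) \<partial>lborel) =
        emeasure lborel {x :: real ^ 2. \<gamma> < s z * norm x powr (- \<alpha>)}"
      by simp
  qed
  also have "\<dots> = (\<integral>\<^sup>+z. ennreal pi * ennreal ((max 0 (s z) / \<gamma>) powr (2 / \<alpha>)) \<partial>Q)"
    using pos by (simp add: emeasure_sensing_region ennreal_mult)
  also have "\<dots> = ennreal (pi * c)"
    by (subst nn_integral_cmult) (simp_all add: moment ennreal_mult pos)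
  finally have nn: "(\<integral>\<^sup>+x. ennreal (v x) \<partial>lborel) = ennreal (pi * c)" .
  have v0: "0 \<le> v x" for x by (simp add: v_def)
  have int: "integrable lborel v"
    using nn v0 by (intro integrableI_nonneg) auto
  have "(\<integral>x. v x \<partial>lborel) = pi * c"
    using nn v0 pos by (subst integral_eq_nn_integral) auto
  then show ?thesis
    using prob_all_marked[OF R, folded v_def, OF int] by (simp add: R_def)
qed

section \<open>Moments of the fading gain and of the received strength\<close>

lemma nn_integral_fading_powr:
  assumes "p > 0"
  shows "(\<integral>\<^sup>+h. ennreal (max 0 h powr p) \<partial>fading_law) = ennreal (Gamma (p + 1))"
proof -
  \<comment> \<open>The negative half-line has density 0, and on the rest \<open>max 0\<close> is
    the identity; what remains is Euler's integral for Gamma at \<open>p + 1\<close>.\<close>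
  have "(\<integral>\<^sup>+h. ennreal (max 0 h powr p) \<partial>fading_law) =
      (\<integral>\<^sup>+t. ennreal (indicator {0..} t * t powr (p + 1 - 1) / exp t) \<partial>lborel)"
    unfolding fading_law_def
    by (subst nn_integral_density)
       (auto intro!: nn_integral_cong simp: exponential_density_def exp_minus field_simps
         indicator_def simp flip: ennreal_mult)
  also have "\<dots> = ennreal (Gamma (p + 1))"
    using assms by (intro Gamma_conv_nn_integral_real[symmetric]) simp
  finally show ?thesis .
qed

lemma prob_space_fading_law: "prob_space fading_law"
  unfolding fading_law_def by (rule prob_space_exponential_density) simp

lemma sets_fading_law [measurable_cong, simp]: "sets fading_law = sets borel"
  by (simp add: fading_law_def)

lemma sets_nearest_bs_distance_law [measurable_cong, simp]:
  "sets (nearest_bs_distance_law l) = sets borel"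
  by (simp add: nearest_bs_distance_law_def)

lemma sets_inversion_power_law [measurable_cong, simp]:
  "sets (inversion_power_law l \<rho> \<alpha>) = sets borel"
  by (simp add: inversion_power_law_def)

lemma nn_integral_nearest_bs:
  assumes f[measurable]: "f \<in> borel_measurable borel"
  shows "(\<integral>\<^sup>+r. f r \<partial>nearest_bs_distance_law l) =
    (\<integral>\<^sup>+r. ennreal (if r > 0 then 2 * pi * l * r * exp (- pi * l * r\<^sup>2) else 0) * f r \<partial>lborel)"
  unfolding nearest_bs_distance_law_def by (rule nn_integral_density) measurable

lemma prob_space_nearest_bs_distance_law:
  assumes l: "l > 0"
  shows "prob_space (nearest_bs_distance_law l)"
proof
  have "emeasure (nearest_bs_distance_law l) (space (nearest_bs_distance_law l)) =
      (\<integral>\<^sup>+r. 1 \<partial>nearest_bs_distance_law l)"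
    by simp
  \<comment> \<open>The endpoint 0 may be included, because the integrand vanishes there.\<close>
  also have "\<dots> = (\<integral>\<^sup>+r. ennreal (2 * pi * l * r * exp (- pi * l * r\<^sup>2)) * indicator {0..} r \<partial>lborel)"
    by (subst nn_integral_nearest_bs) (auto intro!: nn_integral_cong simp: indicator_def)
  also have "\<dots> = ennreal (0 - (- exp (- pi * l * 0\<^sup>2)))"
  proof (rule nn_integral_FTC_atLeast)
    show "((\<lambda>r. - exp (- pi * l * r\<^sup>2)) \<longlongrightarrow> 0) at_top"
      using l by real_asymp
    show "((\<lambda>r. - exp (- pi * l * r\<^sup>2)) has_real_derivative 2 * pi * l * r * exp (- pi * l * r\<^sup>2)) (at r)" for r
      by (auto intro!: derivative_eq_intros)
  qed (use l in auto)
  finally show "emeasure (nearest_bs_distance_law l) (space (nearest_bs_distance_law l)) = 1"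
    by simp
qed

lemma prob_space_inversion_power_law:
  "l > 0 \<Longrightarrow> prob_space (inversion_power_law l \<rho> \<alpha>)"
  unfolding inversion_power_law_def
  by (intro prob_space.prob_space_distr prob_space_nearest_bs_distance_law) auto

text \<open>The exponents \<open>\<alpha>\<close> and \<open>2 / \<alpha>\<close> multiply to 2, so
  up to the factor \<open>\<rho> powr (2 / \<alpha>)\<close> this is the second moment of the
  distance, whatever the path loss.\<close>

lemma nn_integral_inversion_powr:
  assumes l: "l > 0" and \<rho>: "\<rho> > 0" and \<alpha>: "\<alpha> > 0"
  shows "(\<integral>\<^sup>+p. ennreal (max 0 p powr (2 / \<alpha>)) \<partial>inversion_power_law l \<rho> \<alpha>) =
    ennreal (\<rho> powr (2 / \<alpha>) / (pi * l))"
proof -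
  have "(\<integral>\<^sup>+p. ennreal (max 0 p powr (2 / \<alpha>)) \<partial>inversion_power_law l \<rho> \<alpha>) =
      (\<integral>\<^sup>+r. ennreal (max 0 (\<rho> * r powr \<alpha>) powr (2 / \<alpha>)) \<partial>nearest_bs_distance_law l)"
    unfolding inversion_power_law_def by (subst nn_integral_distr) auto
  also have "\<dots> = (\<integral>\<^sup>+r. ennreal (\<rho> powr (2 / \<alpha>) * (2 * pi * l * r ^ 3 * exp (- pi * l * r\<^sup>2))) * indicator {0..} r \<partial>lborel)"
  proof (subst nn_integral_nearest_bs, simp, rule nn_integral_cong)
    fix r :: real
    have "(\<rho> * r powr \<alpha>) powr (2 / \<alpha>) = \<rho> powr (2 / \<alpha>) * r\<^sup>2" if "r > 0"
      using that \<rho> \<alpha> by (simp add: powr_mult powr_powr flip: powr_numeral)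
    then show "ennreal (if r > 0 then 2 * pi * l * r * exp (- pi * l * r\<^sup>2) else 0) *
        ennreal (max 0 (\<rho> * r powr \<alpha>) powr (2 / \<alpha>)) =
        ennreal (\<rho> powr (2 / \<alpha>) * (2 * pi * l * r ^ 3 * exp (- pi * l * r\<^sup>2))) * indicator {0..} r"
      using \<rho> l
      by (auto simp: indicator_def power2_eq_square power3_eq_cube mult_ac simp flip: ennreal_mult)
  qed
  \<comment> \<open>Integration by parts supplies the antiderivative
    \<open>- (r\<^sup>2 + 1 / (pi * l)) * exp (- pi * l * r\<^sup>2)\<close>, up to the factor
    \<open>\<rho> powr (2 / \<alpha>)\<close>. It vanishes at infinity, and its value at 0 leaves
    \<open>1 / (pi * l)\<close>.\<close>
  also have "\<dots> = ennreal (0 - (- (\<rho> powr (2 / \<alpha>) * ((0\<^sup>2 + 1 / (pi * l)) * exp (- pi * l * 0\<^sup>2)))))"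
  proof (rule nn_integral_FTC_atLeast)
    show "((\<lambda>r. - (\<rho> powr (2 / \<alpha>) * ((r\<^sup>2 + 1 / (pi * l)) * exp (- pi * l * r\<^sup>2)))) \<longlongrightarrow> 0) at_top"
      using l by real_asymp
    show "((\<lambda>r. - (\<rho> powr (2 / \<alpha>) * ((r\<^sup>2 + 1 / (pi * l)) * exp (- pi * l * r\<^sup>2)))) has_real_derivative
        \<rho> powr (2 / \<alpha>) * (2 * pi * l * r ^ 3 * exp (- pi * l * r\<^sup>2))) (at r)" for r
      using l by (auto intro!: derivative_eq_intros simp: field_simps power2_eq_square power3_eq_cube)
  qed (use l in auto)
  finally show ?thesis by simp
qed

text \<open>A positive factor passes through \<open>max 0\<close>, so the power leaves the integral.
  The case \<open>P = 1\<close> also supplies the fading part of the uplink moment.\<close>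

lemma downlink_moment:
  assumes "P > 0" "\<gamma> > 0" "\<alpha> > 0"
  shows "(\<integral>\<^sup>+h. ennreal ((max 0 (P * h) / \<gamma>) powr (2 / \<alpha>)) \<partial>fading_law) =
    ennreal ((P / \<gamma>) powr (2 / \<alpha>) * Gamma (2 / \<alpha> + 1))"
proof -
  have "(max 0 (P * h) / \<gamma>) powr (2 / \<alpha>) = (P / \<gamma>) powr (2 / \<alpha>) * max 0 h powr (2 / \<alpha>)" for h
  proof -
    have eq: "max 0 (P * h) / \<gamma> = (P / \<gamma>) * max 0 h"
      using assms by (auto simp: max_def zero_le_mult_iff)
    show ?thesis
      unfolding eq by (subst powr_mult) (use assms in auto)
  qed
  then have "(\<integral>\<^sup>+h. ennreal ((max 0 (P * h) / \<gamma>) powr (2 / \<alpha>)) \<partial>fading_law) =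
      (\<integral>\<^sup>+h. ennreal ((P / \<gamma>) powr (2 / \<alpha>)) * ennreal (max 0 h powr (2 / \<alpha>)) \<partial>fading_law)"
    by (simp add: ennreal_mult')
  also have "\<dots> = ennreal ((P / \<gamma>) powr (2 / \<alpha>)) * ennreal (Gamma (2 / \<alpha> + 1))"
    using assms by (subst nn_integral_cmult) (simp_all add: nn_integral_fading_powr)
  finally show ?thesis
    by (simp add: ennreal_mult')
qed

text \<open>Under the product law gain and power are independent, so the moment of their product
  factors.\<close>

lemma uplink_moment:
  assumes "l > 0" "\<rho> > 0" "\<gamma> > 0" "\<alpha> > 0"
  shows "(\<integral>\<^sup>+z. ennreal ((max 0 (snd z * fst z) / \<gamma>) powr (2 / \<alpha>))
      \<partial>(fading_law \<Otimes>\<^sub>M inversion_power_law l \<rho> \<alpha>)) =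
    ennreal ((\<rho> / \<gamma>) powr (2 / \<alpha>) * Gamma (2 / \<alpha> + 1) / (pi * l))"
proof -
  interpret I: prob_space "inversion_power_law l \<rho> \<alpha>"
    using assms by (intro prob_space_inversion_power_law)
  \<comment> \<open>The positive part of \<open>p * h\<close> is the product of the positive parts
    unless both factors are negative; nonnegative powers exclude that case.\<close>
  have AE_pos: "AE p in inversion_power_law l \<rho> \<alpha>. 0 \<le> p"
    unfolding inversion_power_law_def using assms by (subst AE_distr_iff) auto
  have "(\<integral>\<^sup>+z. ennreal ((max 0 (snd z * fst z) / \<gamma>) powr (2 / \<alpha>))
      \<partial>(fading_law \<Otimes>\<^sub>M inversion_power_law l \<rho> \<alpha>)) =
      (\<integral>\<^sup>+h. \<integral>\<^sup>+p. ennreal ((max 0 (p * h) / \<gamma>) powr (2 / \<alpha>)) \<partial>inversion_power_law l \<rho> \<alpha> \<partial>fading_law)"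
    by (subst I.nn_integral_fst[symmetric]) auto
  also have "\<dots> = (\<integral>\<^sup>+h. \<integral>\<^sup>+p. ennreal ((max 0 h / \<gamma>) powr (2 / \<alpha>)) * ennreal (max 0 p powr (2 / \<alpha>))
      \<partial>inversion_power_law l \<rho> \<alpha> \<partial>fading_law)"
  proof (rule nn_integral_cong, rule nn_integral_cong_AE)
    fix h
    show "AE p in inversion_power_law l \<rho> \<alpha>. ennreal ((max 0 (p * h) / \<gamma>) powr (2 / \<alpha>)) =
        ennreal ((max 0 h / \<gamma>) powr (2 / \<alpha>)) * ennreal (max 0 p powr (2 / \<alpha>))"
      using AE_pos
    proof eventually_elim
      case (elim p)
      then have eq: "max 0 (p * h) / \<gamma> = (max 0 h / \<gamma>) * max 0 p"
        by (auto simp: max_def zero_le_mult_iff)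
      show ?case
        unfolding eq by (subst powr_mult) (use assms in \<open>auto simp: ennreal_mult'\<close>)
    qed
  qed
  \<comment> \<open>The factor 1 brings the fading integral into the form of
    \<open>downlink_moment\<close>.\<close>
  also have "\<dots> = (\<integral>\<^sup>+h. ennreal ((max 0 (1 * h) / \<gamma>) powr (2 / \<alpha>)) * ennreal (\<rho> powr (2 / \<alpha>) / (pi * l)) \<partial>fading_law)"
    using assms by (subst nn_integral_cmult) (simp_all add: nn_integral_inversion_powr)
  also have "\<dots> = ennreal ((1 / \<gamma>) powr (2 / \<alpha>) * Gamma (2 / \<alpha> + 1)) * ennreal (\<rho> powr (2 / \<alpha>) / (pi * l))"
    using assms downlink_moment[of 1 \<gamma> \<alpha>] by (subst nn_integral_multc) simp_all
  also have "\<dots> = ennreal ((\<rho> / \<gamma>) powr (2 / \<alpha>) * Gamma (2 / \<alpha> + 1) / (pi * l))"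
    using assms by (subst ennreal_mult''[symmetric]) (simp_all add: powr_divide mult_ac)
  finally show ?thesis .
qed

section \<open>Downlink and uplink as instances of one mark model\<close>

theorem lemma4:
  fixes M :: "'w measure"
    and X :: "nat \<Rightarrow> 'w \<Rightarrow> real ^ 2"
    and h P :: "nat \<Rightarrow> 'w \<Rightarrow> real"
    and lam_B lam_U P\<^sub>B \<rho>\<^sub>b \<gamma> \<alpha> q\<^sub>d :: real
    and C\<^sub>D C\<^sub>U :: "'c set" and c\<^sub>d :: 'c
    and policy :: access_policy
  assumes "lam_B > 0" and "lam_U > 0" and "P\<^sub>B > 0" and "\<rho>\<^sub>b > 0" and "\<gamma> > 0" and "\<alpha> > 2"
    and "finite C\<^sub>D" and "finite C\<^sub>U" and "C\<^sub>D \<inter> C\<^sub>U = {}" and "c\<^sub>d \<in> C\<^sub>D \<union> C\<^sub>U"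
    and "q\<^sub>d = channel_use_prob policy (card (C\<^sub>D \<union> C\<^sub>U)) (user_count_pmf (lam_U / lam_B))"
    and "prob_space M"
    and "poisson_process M (q\<^sub>d * lam_B) X"
    and downlink: "c\<^sub>d \<in> C\<^sub>D \<Longrightarrow>
      independent_marks M X fading_law h \<and> (\<forall>i. \<forall>\<omega>\<in>space M. P i \<omega> = P\<^sub>B)"
    and uplink: "c\<^sub>d \<in> C\<^sub>U \<Longrightarrow>
      independent_marks M X (fading_law \<Otimes>\<^sub>M inversion_power_law lam_B \<rho>\<^sub>b \<alpha>) (\<lambda>i \<omega>. (h i \<omega>, P i \<omega>))"
  shows "measure M (channel_free_event M \<alpha> \<gamma> X P h) =
    exp (- (if c\<^sub>d \<in> C\<^sub>D
            then pi * lam_B * (P\<^sub>B / \<gamma>) powr (2 / \<alpha>) * Gamma ((\<alpha> + 2) / \<alpha>)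
            else (\<rho>\<^sub>b / \<gamma>) powr (2 / \<alpha>) * Gamma ((\<alpha> + 2) / \<alpha>)) * q\<^sub>d)"
proof -
  have poisson: "poisson_points M (q\<^sub>d * lam_B) X"
    using assms by (intro poisson_points.intro poisson_points_axioms.intro)
  have "\<alpha> > 0" using \<open>\<alpha> > 2\<close> by simp
  then have Gamma_arg: "(\<alpha> + 2) / \<alpha> = 2 / \<alpha> + 1"
    by (simp add: field_simps)
  \<comment> \<open>This makes the moment constant nonnegative, as
    \<open>prob_no_strong_signal\<close> requires.\<close>
  have "0 \<le> Gamma (2 / \<alpha> + 1)"
    using \<open>\<alpha> > 0\<close> by (intro Gamma_real_nonneg add_pos_pos) auto
  show ?thesis
  proof (cases "c\<^sub>d \<in> C\<^sub>D")
    case True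
    \<comment> \<open>The power is constant, so the gain alone serves as the mark.\<close>
    have "channel_free_event M \<alpha> \<gamma> X P h =
        {\<omega> \<in> space M. \<not> (\<exists>i. P\<^sub>B * h i \<omega> * norm (X i \<omega>) powr (- \<alpha>) > \<gamma>)}"
      using downlink[OF True] by (auto simp: channel_free_event_def)
    also have "measure M \<dots> =
        exp (- (q\<^sub>d * lam_B * (pi * ((P\<^sub>B / \<gamma>) powr (2 / \<alpha>) * Gamma (2 / \<alpha> + 1)))))"
      by (rule prob_no_strong_signal[where s = "\<lambda>h. P\<^sub>B * h" and Q = fading_law])
         (use poisson downlink[OF True] assms \<open>\<alpha> > 0\<close> \<open>0 \<le> Gamma (2 / \<alpha> + 1)\<close> in
           \<open>auto simp: downlink_moment intro!: marked_poisson_points.intro marked_poisson_points_axioms.intro\<close>)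
    finally show ?thesis
      using True by (simp add: Gamma_arg mult_ac)
  next
    case False
    then have up: "c\<^sub>d \<in> C\<^sub>U" using assms by auto
    \<comment> \<open>The mark is the pair of gain and power, in the order of the product
      law.\<close>
    have "channel_free_event M \<alpha> \<gamma> X P h =
        {\<omega> \<in> space M. \<not> (\<exists>i. snd (h i \<omega>, P i \<omega>) * fst (h i \<omega>, P i \<omega>) * norm (X i \<omega>) powr (- \<alpha>) > \<gamma>)}"
      by (simp add: channel_free_event_def)
    also have "measure M \<dots> =
        exp (- (q\<^sub>d * lam_B * (pi * ((\<rho>\<^sub>b / \<gamma>) powr (2 / \<alpha>) * Gamma (2 / \<alpha> + 1) / (pi * lam_B)))))"
      by (rule prob_no_strong_signal[where s = "\<lambda>z. snd z * fst z"
            and Q = "fading_law \<Otimes>\<^sub>M inversion_power_law lam_B \<rho>\<^sub>b \<alpha>" and Z = "\<lambda>i \<omega>. (h i \<omega>, P i \<omega>)"])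
         (use poisson uplink[OF up] assms \<open>\<alpha> > 0\<close> \<open>0 \<le> Gamma (2 / \<alpha> + 1)\<close> in
           \<open>auto simp: uplink_moment intro!: marked_poisson_points.intro marked_poisson_points_axioms.intro\<close>)
    finally show ?thesis
      using False assms by (simp add: Gamma_arg mult_ac)
  qed
qed

end
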